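(* For every $\alpha\in\Phi_\omega$ there is $r\in\mathbb{N}$ such that either $\alpha=o(r)$ or $o(r)+\omega\preceq\alpha$.
   Context: Constructive ordinals: $\Omega$ is the set of infinitary terms generated by $0$, successor $\alpha+1$, and limits $\langle\alpha_i\rangle_{i\in\mathbb{N}}$; equality is syntactic. $\prec$ is the transitive closure of $\alpha\prec\alpha+1$ and $\alpha_m\prec\langle\alpha_i\rangle_i$; $\alpha\preceq\beta$ iff $\alpha\prec\beta$ or $\alpha=\beta$. $o(0)=0$, $o(n+1)=o(n)+1$, $\omega=\langle o(i+1)\rangle_i$. Arithmetic: $\alpha+0=\alpha$, $\alpha+(\beta+1)=(\alpha+\beta)+1$, $\alpha+\langle\beta_i\rangle=\langle\alpha+\beta_i\rangle$; $\alpha\cdot0=0$, $\alpha\cdot(\beta+1)=\alpha\cdot\beta+\alpha$, $\alpha\cdot\langle\beta_i\rangle=\langle\alpha\cdot\beta_i\rangle$; $\alpha^0=o(1)$, $\alpha^{\beta+1}=\alpha^\beta\cdot\alpha$, $\alpha^{\langle\beta_i\rangle}=\langle\alpha^{\beta_i}\rangle$. Veblen functions: $\phi_0(\gamma)=\omega^\gamma$; $\phi_{k+1}(0)=\langle\phi_k^{(i)}(0)\rangle_i$; $\phi_{k+1}(\gamma+1)=\langle\phi_k^{(i)}(\phi_{k+1}(\gamma)+1)\rangle_i$; $\phi_{k+1}(\langle\gamma_i\rangle)=\langle\phi_{k+1}(\gamma_i)\rangle_i$. $\Phi_\omega$ is the smallest subset of $\Omega$ containing $0$ and closed under $+$ and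 all $\phi_i$, $i\in\mathbb{N}$. *)

theory Defs
  imports Main
begin

datatype oterm = Zero | Succ oterm | Lim "nat \<Rightarrow> oterm"

inductive prec1 :: "oterm \<Rightarrow> oterm \<Rightarrow> bool" where
  "prec1 \<alpha> (Succ \<alpha>)"
| "prec1 (a m) (Lim a)"

definition prec :: "oterm \<Rightarrow> oterm \<Rightarrow> bool" (infix "\<prec>" 50) where
  "\<alpha> \<prec> \<beta> \<longleftrightarrow> prec1\<^sup>+\<^sup>+ \<alpha> \<beta>"

definition preceq :: "oterm \<Rightarrow> oterm \<Rightarrow> bool" (infix "\<preceq>" 50) where
  "\<alpha> \<preceq> \<beta> \<longleftrightarrow> \<alpha> \<prec> \<beta> \<or> \<alpha> = \<beta>"

primrec fin_ord :: "nat \<Rightarrow> oterm" where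
  "fin_ord 0 = Zero"
| "fin_ord (Suc n) = Succ (fin_ord n)"

definition omega :: oterm where
  "omega = Lim (\<lambda>i. fin_ord (i + 1))"

primrec oadd :: "oterm \<Rightarrow> oterm \<Rightarrow> oterm" (infixl "\<oplus>" 65) where
  "\<alpha> \<oplus> Zero = \<alpha>"
| "\<alpha> \<oplus> Succ \<beta> = Succ (\<alpha> \<oplus> \<beta>)"
| "\<alpha> \<oplus> Lim b = Lim (\<lambda>i. \<alpha> \<oplus> b i)"

primrec omult :: "oterm \<Rightarrow> oterm \<Rightarrow> oterm" (infixl "\<otimes>" 70) where
  "\<alpha> \<otimes> Zero = Zero"
| "\<alpha> \<otimes> Succ \<beta> = \<alpha> \<otimes> \<beta> \<oplus> \<alpha>"
| "\<alpha> \<otimes> Lim b = Lim (\<lambda>i. \<alpha> \<otimes> b i)"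

primrec oexp :: "oterm \<Rightarrow> oterm \<Rightarrow> oterm" where
  "oexp \<alpha> Zero = fin_ord 1"
| "oexp \<alpha> (Succ \<beta>) = oexp \<alpha> \<beta> \<otimes> \<alpha>"
| "oexp \<alpha> (Lim b) = Lim (\<lambda>i. oexp \<alpha> (b i))"

text \<open>The passage from \<open>\<phi>\<^sub>k\<close> to \<open>\<phi>\<^sub>k\<^sub>+\<^sub>1\<close>, separated out so that both recursions
  (on the index and on the argument) are primitive.\<close>

primrec veblen_step :: "(oterm \<Rightarrow> oterm) \<Rightarrow> oterm \<Rightarrow> oterm" where
  "veblen_step f Zero = Lim (\<lambda>i. (f ^^ i) Zero)"
| "veblen_step f (Succ \<gamma>) = Lim (\<lambda>i. (f ^^ i) (Succ (veblen_step f \<gamma>)))"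
| "veblen_step f (Lim g) = Lim (\<lambda>i. veblen_step f (g i))"

primrec veblen :: "nat \<Rightarrow> oterm \<Rightarrow> oterm" where
  "veblen 0 = oexp omega"
| "veblen (Suc k) = veblen_step (veblen k)"

lemma veblen_equations:
  "veblen 0 \<gamma> = oexp omega \<gamma>"
  "veblen (Suc k) Zero = Lim (\<lambda>i. (veblen k ^^ i) Zero)"
  "veblen (Suc k) (Succ \<gamma>) = Lim (\<lambda>i. (veblen k ^^ i) (Succ (veblen (Suc k) \<gamma>)))"
  "veblen (Suc k) (Lim g) = Lim (\<lambda>i. veblen (Suc k) (g i))"
  by simp_all

inductive_set Phi_omega :: "oterm set" where
  "Zero \<in> Phi_omega"
| "\<alpha> \<in> Phi_omega \<Longrightarrow> \<beta> \<in> Phi_omega \<Longrightarrow> \<alpha> \<oplus> \<beta> \<in> Phi_omega"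
| "\<alpha> \<in> Phi_omega \<Longrightarrow> veblen i \<alpha> \<in> Phi_omega"

end

theory Submission
  imports Defs
begin

text \<open>
  Being of the form \<open>o(r)\<close> or lying above some \<open>o(r) + \<omega>\<close> is preserved by sums, since addition
  is associative and monotone on the right. For the Veblen functions one shows more than needed:
  \<open>\<omega> \<preceq> \<phi>\<^sub>k\<^sub>+\<^sub>1(\<gamma>)\<close> for every term \<open>\<gamma>\<close>, and \<open>\<omega> = \<omega>\<^sup>1 \<preceq> \<omega>\<^sup>\<gamma>\<close> whenever \<open>o(1) \<preceq> \<gamma>\<close>. The latter
  hypothesis is not implied by \<open>\<gamma> \<noteq> 0\<close>, as the limit of the constant sequence \<open>0\<close> shows.
\<close>

lemma preceq_iff_rtranclp: "\<alpha> \<preceq> \<beta> \<longleftrightarrow> prec1\<^sup>*\<^sup>* \<alpha> \<beta>"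
  by (auto simp: preceq_def prec_def dest: rtranclpD tranclp_into_rtranclp)

lemma preceq_refl [simp]: "\<alpha> \<preceq> \<alpha>"
  by (simp add: preceq_def)

lemma preceq_trans [trans]: "\<alpha> \<preceq> \<beta> \<Longrightarrow> \<beta> \<preceq> \<gamma> \<Longrightarrow> \<alpha> \<preceq> \<gamma>"
  by (simp add: preceq_iff_rtranclp)

lemma preceq_Succ: "\<alpha> \<preceq> \<beta> \<Longrightarrow> \<alpha> \<preceq> Succ \<beta>"
  unfolding preceq_iff_rtranclp by (rule rtranclp.rtrancl_into_rtrancl) (auto intro: prec1.intros)

lemma preceq_Lim: "\<alpha> \<preceq> a m \<Longrightarrow> \<alpha> \<preceq> Lim a"
  unfolding preceq_iff_rtranclp by (rule rtranclp.rtrancl_into_rtrancl) (auto intro: prec1.intros)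

text \<open>As \<open>\<preceq>\<close> is the reflexive transitive closure of \<open>prec1\<close>,
  monotonicity need only be checked on the two generating steps.\<close>

lemma mono_preceqI:
  assumes Succ: "\<And>\<gamma>. f \<gamma> \<preceq> f (Succ \<gamma>)"
    and Lim: "\<And>a m. f (a m) \<preceq> f (Lim a)"
    and "\<alpha> \<preceq> \<beta>"
  shows "f \<alpha> \<preceq> f \<beta>"
  using \<open>\<alpha> \<preceq> \<beta>\<close> unfolding preceq_iff_rtranclp[of \<alpha> \<beta>]
proof (induction rule: rtranclp_induct)
  case (step \<beta> \<gamma>)
  from step.hyps(2) have "f \<beta> \<preceq> f \<gamma>"
    by cases (simp_all add: Succ Lim)
  with step.IH show ?case
    by (rule preceq_trans)
qed simp

lemma oadd_assoc: "\<alpha> \<oplus> \<beta> \<oplus> \<gamma> = \<alpha> \<oplus> (\<beta> \<oplus> \<gamma>)"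
  by (induction \<gamma>) simp_all

lemma Zero_oadd [simp]: "Zero \<oplus> \<alpha> = \<alpha>"
  by (induction \<alpha>) simp_all

lemma fin_ord_add: "fin_ord (r + s) = fin_ord r \<oplus> fin_ord s"
  by (induction s) simp_all

lemma preceq_oadd: "\<alpha> \<preceq> \<alpha> \<oplus> \<beta>"
  by (induction \<beta>) (auto intro: preceq_Succ preceq_Lim)

lemma oadd_mono_right: "\<beta> \<preceq> \<gamma> \<Longrightarrow> \<alpha> \<oplus> \<beta> \<preceq> \<alpha> \<oplus> \<gamma>"
proof (rule mono_preceqI[where f = "\<lambda>\<gamma>. \<alpha> \<oplus> \<gamma>"])
  show "\<alpha> \<oplus> a m \<preceq> \<alpha> \<oplus> Lim a" for a m
    using preceq_Lim[of _ "\<lambda>i. \<alpha> \<oplus> a i" m] by simp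
qed (simp_all add: preceq_Succ)

text \<open>Equality of terms is syntactic and \<open>oexp omega (fin_ord 1)\<close> unfolds to
  \<open>fin_ord 1 \<otimes> omega\<close>; this identifies it with \<open>omega\<close> component
  by component.\<close>

lemma fin_ord_1_omult_fin_ord: "fin_ord 1 \<otimes> fin_ord n = fin_ord n"
  by (induction n) simp_all

lemma oexp_omega_1: "oexp omega (fin_ord 1) = omega"
  using fin_ord_1_omult_fin_ord by (simp add: omega_def)

text \<open>The sequence of \<open>omega\<close> starts at \<open>fin_ord 1\<close>, so component 0
  of the product is \<alpha> itself.\<close>

lemma preceq_omult_omega: "\<alpha> \<preceq> \<alpha> \<otimes> omega"
  unfolding omega_def by (auto intro: preceq_Lim[where m = 0])

lemma oexp_omega_mono: "\<alpha> \<preceq> \<beta> \<Longrightarrow> oexp omega \<alpha> \<preceq> oexp omega \<beta>"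
proof (rule mono_preceqI[where f = "oexp omega"])
  show "oexp omega (a m) \<preceq> oexp omega (Lim a)" for a m
    using preceq_Lim[of _ "\<lambda>i. oexp omega (a i)" m] by simp
qed (simp_all add: preceq_omult_omega)

lemma omega_preceq_oexp_omega:
  assumes "fin_ord 1 \<preceq> \<alpha>"
  shows "omega \<preceq> oexp omega \<alpha>"
  using oexp_omega_mono[OF assms] by (simp only: oexp_omega_1)

lemma omega_preceq_veblen_step:
  assumes "omega \<preceq> veblen_step f Zero"
  shows "omega \<preceq> veblen_step f \<gamma>"
proof (induction \<gamma>)
  case (Succ \<gamma>)
  then show ?case
    \<comment> \<open>Component 0 is the zeroth iterate, the successor of the value at
      \<gamma>.\<close>
    by (auto intro!: preceq_Lim[where m = 0] preceq_Succ)
next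
  case (Lim g)
  then show ?case
    by (auto intro: preceq_Lim)
qed (rule assms)

lemma omega_preceq_veblen_Suc: "omega \<preceq> veblen (Suc k) \<gamma>"
proof -
  have "omega \<preceq> veblen (Suc k) Zero"
  proof (induction k)
    case 0
    \<comment> \<open>The first iterate is only \<open>fin_ord 1\<close>; the second is
      \<open>oexp omega (fin_ord 1)\<close>, that is, \<open>omega\<close>.\<close>
    have "omega \<preceq> (veblen 0 ^^ 2) Zero"
      using oexp_omega_1 by (simp add: numeral_2_eq_2)
    then show ?case
      unfolding veblen_equations by (rule preceq_Lim)
  next
    case (Suc k)
    then have "omega \<preceq> (veblen (Suc k) ^^ 1) Zero"
      by simp
    then show ?case
      unfolding veblen_equations(2)[of "Suc k"] by (rule preceq_Lim)
  qed
  then show ?thesis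
    by (simp add: omega_preceq_veblen_step)
qed

lemma fin_ord_1_preceq_fin_ord_Suc: "fin_ord 1 \<preceq> fin_ord (Suc n)"
  using preceq_oadd[of "fin_ord 1" "fin_ord n"] fin_ord_add[of 1 n] by simp

lemma fin_ord_1_preceq_fin_ord_oadd_omega: "fin_ord 1 \<preceq> fin_ord r \<oplus> omega"
  unfolding omega_def
  using fin_ord_1_preceq_fin_ord_Suc[of r] by (auto intro: preceq_Lim[where m = 0])

theorem theorem6p24:
  fixes \<alpha> :: oterm
  assumes "\<alpha> \<in> Phi_omega"
  shows "\<exists>r::nat. \<alpha> = fin_ord r \<or> fin_ord r \<oplus> omega \<preceq> \<alpha>"
  using assms
proof induction
  case 1
  show ?case
    by (intro exI[of _ 0]) simp
next
  case (2 \<alpha> \<beta>)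
  then obtain r s where r: "\<alpha> = fin_ord r \<or> fin_ord r \<oplus> omega \<preceq> \<alpha>"
    and s: "\<beta> = fin_ord s \<or> fin_ord s \<oplus> omega \<preceq> \<beta>"
    by blast
  from r show ?case
  proof
    assume \<alpha>: "\<alpha> = fin_ord r"
    from s have "\<alpha> \<oplus> \<beta> = fin_ord (r + s) \<or> fin_ord (r + s) \<oplus> omega \<preceq> \<alpha> \<oplus> \<beta>"
      \<comment> \<open>Regrouping turns the bound into
        \<open>fin_ord r \<oplus> (fin_ord s \<oplus> omega)\<close>, so right monotonicity
        applies.\<close>
      unfolding \<alpha> fin_ord_add oadd_assoc by (auto intro: oadd_mono_right)
    then show ?case ..
  next
    assume "fin_ord r \<oplus> omega \<preceq> \<alpha>"
    then show ?case
      using preceq_oadd preceq_trans by blast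
  qed
next
  case (3 \<alpha> i)
  \<comment> \<open>The induction hypothesis excludes nonzero terms not above
    \<open>fin_ord 1\<close>.\<close>
  have "\<alpha> = Zero \<or> fin_ord 1 \<preceq> \<alpha>"
  proof -
    from 3 obtain r where "\<alpha> = fin_ord r \<or> fin_ord r \<oplus> omega \<preceq> \<alpha>"
      by blast
    then show ?thesis
      using fin_ord_1_preceq_fin_ord_Suc fin_ord_1_preceq_fin_ord_oadd_omega
      by (metis fin_ord.simps(1) not0_implies_Suc preceq_trans)
  qed
  \<comment> \<open>The finite value arises from \<open>oexp omega Zero\<close>. The witnesses are r
    = 1 for it and r = 0 otherwise.\<close>
  then have "veblen i \<alpha> = fin_ord 1 \<or> omega \<preceq> veblen i \<alpha>"
    using omega_preceq_veblen_Suc omega_preceq_oexp_omega by (cases i) auto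
  then show ?case
    by (metis Zero_oadd fin_ord.simps(1))
qed

end
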